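(* Let $G$ be a finite simple connected graph of order $n(G)$ and let $k\ge \ell\ge 0$ be integers. Then $\mathrm{f}\mu^{k}(G)=n(G)-\ell$ if and only if $\omega(G)=n(G)-\ell$, where $\omega(G)$ is the clique number of $G$.
   Context: For an integer $k\ge 0$ and a connected graph $G$, a set $X\subseteq V(G)$ is a $k$-fault-tolerant mutual-visibility set ($k$-ftmv set) if for any two non-adjacent vertices $u,v\in X$ there exist $k+1$ internally vertex-disjoint shortest $u,v$-paths $Q_1,\dots,Q_{k+1}$ in $G$ such that $V(Q_i)\cap X=\{u,v\}$ for every $i$. $\mathrm{f}\mu^{k}(G)$ denotes the maximum cardinality of a $k$-ftmv set of $G$. *)

theory Defs
  imports "Graph_Theory.Graph_Theory"
begin

text \<open>
  As in \<^theory>\<open>Graph_Theory.Digraph\<close>, a finite simple graph is a finite symmetric digraph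
  without loops and parallel arcs (locale \<^locale>\<open>graph\<close>). The locale allows the graph without
  vertices; \<^const>\<open>connected\<close> excludes it.
\<close>

definition shortest_path :: "('a, 'b) pre_digraph \<Rightarrow> 'a \<Rightarrow> 'b awalk \<Rightarrow> 'a \<Rightarrow> bool" where
  "shortest_path G u p v \<longleftrightarrow>
     pre_digraph.apath G u p v \<and> (\<forall>q. pre_digraph.apath G u q v \<longrightarrow> length p \<le> length q)"

definition internally_disjoint ::
    "('a, 'b) pre_digraph \<Rightarrow> 'b awalk \<Rightarrow> 'b awalk \<Rightarrow> bool" where
  "internally_disjoint G p q \<longleftrightarrow>
     set (pre_digraph.inner_verts G p) \<inter> set (pre_digraph.inner_verts G q) = {}"

text \<open>
  Non-adjacent vertices are understood to be distinct. A shortest path between them has an inner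
  vertex, so the paths \<open>Q 1, \<dots>, Q (k + 1)\<close> below are automatically pairwise different.
\<close>

definition ftmv_set :: "('a, 'b) pre_digraph \<Rightarrow> nat \<Rightarrow> 'a set \<Rightarrow> bool" where
  "ftmv_set G k X \<longleftrightarrow> X \<subseteq> verts G \<and>
     (\<forall>u\<in>X. \<forall>v\<in>X. u \<noteq> v \<and> \<not> u \<rightarrow>\<^bsub>G\<^esub> v \<longrightarrow>
       (\<exists>Q :: nat \<Rightarrow> 'b awalk.
          (\<forall>i\<in>{1..k + 1}. shortest_path G u (Q i) v) \<and>
          (\<forall>i\<in>{1..k + 1}. \<forall>j\<in>{1..k + 1}. i \<noteq> j \<longrightarrow> internally_disjoint G (Q i) (Q j)) \<and>
          (\<forall>i\<in>{1..k + 1}. set (pre_digraph.awalk_verts G u (Q i)) \<inter> X = {u, v})))"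

definition ftmv_number :: "('a, 'b) pre_digraph \<Rightarrow> nat \<Rightarrow> nat" where
  "ftmv_number G k = Max {card X | X. ftmv_set G k X}"

definition clique :: "('a, 'b) pre_digraph \<Rightarrow> 'a set \<Rightarrow> bool" where
  "clique G S \<longleftrightarrow> S \<subseteq> verts G \<and> (\<forall>u\<in>S. \<forall>v\<in>S. u \<noteq> v \<longrightarrow> u \<rightarrow>\<^bsub>G\<^esub> v)"

definition clique_number :: "('a, 'b) pre_digraph \<Rightarrow> nat" where
  "clique_number G = Max {card S | S. clique G S}"

end

theory Submission
  imports Defs
begin

text \<open>
  Every clique is vacuously a \<open>k\<close>-ftmv set. Conversely, if a \<open>k\<close>-ftmv set \<open>X\<close> contains two
  non-adjacent vertices, each of the \<open>k + 1\<close> internally disjoint paths joining them has its own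
  inner vertex outside \<open>X\<close>, so \<open>X\<close> misses at least \<open>k + 1\<close> vertices. Hence a \<open>k\<close>-ftmv set that
  misses at most \<open>k\<close> vertices is a clique.
\<close>

lemma clique_imp_ftmv_set: "clique G X \<Longrightarrow> ftmv_set G k X"
  unfolding clique_def ftmv_set_def by blast

text \<open>A walk without inner vertices has at most one arc: the empty walk would force
  \<open>u = v\<close>, a single arc would make \<open>u\<close> and \<open>v\<close>
  adjacent.\<close>

lemma (in wf_digraph) inner_verts_nonempty:
  assumes "apath u p v" "u \<noteq> v" "\<not> u \<rightarrow>\<^bsub>G\<^esub> v"
  shows "inner_verts p \<noteq> []"
proof
  assume "inner_verts p = []"
  then have "tl p = []"
    by (simp add: inner_verts_def map_tl[symmetric])
  then show False
    using assms by (cases p) (auto simp: apath_simps dest: in_arcs_imp_in_arcs_ends)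
qed

lemma (in fin_digraph) ftmv_set_card_bound:
  assumes X: "ftmv_set G k X" and not_clique: "\<not> clique G X"
  shows "card X + k < card (verts G)"
proof -
  have sub: "X \<subseteq> verts G"
    using X by (simp add: ftmv_set_def)
  then obtain u v where uv: "u \<in> X" "v \<in> X" "u \<noteq> v" "\<not> u \<rightarrow>\<^bsub>G\<^esub> v"
    using not_clique unfolding clique_def by blast
  then obtain Q where
    path: "\<And>i. i \<in> {1..k + 1} \<Longrightarrow> apath u (Q i) v" and
    disj: "\<And>i j. i \<in> {1..k + 1} \<Longrightarrow> j \<in> {1..k + 1} \<Longrightarrow> i \<noteq> j \<Longrightarrow>
      set (inner_verts (Q i)) \<inter> set (inner_verts (Q j)) = {}" and
    avoid: "\<And>i. i \<in> {1..k + 1} \<Longrightarrow> set (awalk_verts u (Q i)) \<inter> X = {u, v}"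
    using X unfolding ftmv_set_def shortest_path_def internally_disjoint_def by metis
  \<comment> \<open>Any inner vertex of \<open>Q i\<close> would serve; \<open>hd\<close> picks one,
    and is meaningful only for indices in \<open>{1..k + 1}\<close>, where the list is
    nonempty.\<close>
  define w where "w i = hd (inner_verts (Q i))" for i
  have inner: "w i \<in> set (inner_verts (Q i))" if "i \<in> {1..k + 1}" for i
    using inner_verts_nonempty[OF path[OF that] uv(3,4)] by (simp add: w_def)
  have "inj_on w {1..k + 1}"
  proof (rule inj_onI, rule ccontr)
    fix i j assume "i \<in> {1..k + 1}" "j \<in> {1..k + 1}" "w i = w j" "i \<noteq> j"
    then show False
      using disj[of i j] inner[of i] inner[of j] by auto
  qed
  moreover have "w i \<in> verts G - X" if i: "i \<in> {1..k + 1}" for i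
  proof -
    \<comment> \<open>On a path, which repeats no vertex, the inner vertices are exactly the
      vertices other than the two ends.\<close>
    have "w i \<in> set (awalk_verts u (Q i)) - {u, v}"
      using inner[OF i] set_inner_verts[OF path[OF i]] by simp
    moreover have "set (awalk_verts u (Q i)) \<subseteq> verts G"
      using path[OF i] by (auto simp: apath_def awalk_def intro: awalk_verts_in_verts)
    ultimately show ?thesis
      using avoid[OF i] by blast
  qed
  ultimately have "k + 1 \<le> card (verts G - X)"
    using card_inj_on_le[of w "{1..k + 1}" "verts G - X"] by (simp add: image_subset_iff)
  then show ?thesis
    using card_Diff_subset[OF finite_subset[OF sub finite_verts] sub] by linarith
qed

text \<open>Finiteness is what makes the \<open>Max\<close> in \<open>ftmv_number\<close> and
  \<open>clique_number\<close> a genuine maximum.\<close>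

lemma (in fin_digraph) finite_card_subsets:
  assumes "\<And>X. P X \<Longrightarrow> X \<subseteq> verts G"
  shows "finite {card X | X. P X}"
proof (rule finite_subset)
  show "{card X | X. P X} \<subseteq> card ` Pow (verts G)"
    using assms by blast
qed simp

lemma (in fin_digraph) card_le_clique_number:
  assumes "clique G S"
  shows "card S \<le> clique_number G"
  unfolding clique_number_def using assms
  by (intro Max_ge finite_card_subsets) (auto simp: clique_def)

lemma (in fin_digraph) card_le_ftmv_number:
  assumes "ftmv_set G k X"
  shows "card X \<le> ftmv_number G k"
  unfolding ftmv_number_def using assms
  by (intro Max_ge finite_card_subsets) (auto simp: ftmv_set_def)

lemma (in fin_digraph) clique_number_attained:
  obtains S where "clique G S" "card S = clique_number G"
proof -
  \<comment> \<open>The empty set witnesses that the maximum is taken over a nonempty set.\<close>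
  have "clique G {}"
    by (simp add: clique_def)
  then have "clique_number G \<in> {card S | S. clique G S}"
    unfolding clique_number_def
    by (intro Max_in finite_card_subsets) (auto simp: clique_def)
  then show thesis
    using that by auto
qed

lemma (in fin_digraph) ftmv_number_attained:
  obtains X where "ftmv_set G k X" "card X = ftmv_number G k"
proof -
  have "ftmv_set G k {}"
    by (simp add: ftmv_set_def)
  then have "ftmv_number G k \<in> {card X | X. ftmv_set G k X}"
    unfolding ftmv_number_def
    by (intro Max_in finite_card_subsets) (auto simp: ftmv_set_def)
  then show thesis
    using that by auto
qed

lemma (in fin_digraph) clique_number_le_ftmv_number:
  "clique_number G \<le> ftmv_number G k"
  by (metis clique_number_attained clique_imp_ftmv_set card_le_ftmv_number)

text \<open>The assumption says that a largest \<open>k\<close>-ftmv set misses at most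
  \<open>k\<close> vertices; such a set is a clique, which gives the inequality opposite to
  \<open>clique_number_le_ftmv_number\<close>.\<close>

lemma (in fin_digraph) ftmv_number_eq_clique_number:
  assumes "card (verts G) \<le> ftmv_number G k + k"
  shows "ftmv_number G k = clique_number G"
proof -
  obtain X where X: "ftmv_set G k X" "card X = ftmv_number G k"
    by (rule ftmv_number_attained)
  then have "clique G X"
    using ftmv_set_card_bound assms by fastforce
  then show ?thesis
    using X card_le_clique_number clique_number_le_ftmv_number[of k] by fastforce
qed

theorem theorem5p1:
  fixes G :: "('a, 'b) pre_digraph" and k l :: nat
  assumes "graph G" and "connected G" and "l \<le> k"
  shows "int (ftmv_number G k) = int (card (verts G)) - int l \<longleftrightarrow>
         int (clique_number G) = int (card (verts G)) - int l"
proof -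
  interpret graph G by fact
  show ?thesis
    \<comment> \<open>If either number is n - l, where n is the order of \<open>G\<close>, then
      \<open>ftmv_number G k\<close> is at least n - l, hence at least n - k, and the two numbers
      coincide.\<close>
    using clique_number_le_ftmv_number[of k] ftmv_number_eq_clique_number[of k] \<open>l \<le> k\<close>
    by linarith
qed

end
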